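(* If $G$ is a $\mathcal B$-free graph, then $$\alpha(G)+\omega(G)\ge |V(G)|-1.$$
   Context: All graphs are finite and simple. $\alpha(G)$ is the stability (independence) number of $G$ and $\omega(G)$ is its clique number. $\overline H$ denotes the complement of $H$. $\mathcal B$ is the class of graphs consisting of all bipartite graphs on exactly six vertices that have a perfect matching, together with the complements of these graphs. A graph $G$ is $\mathcal B$-free if no induced subgraph of $G$ is isomorphic to a member of $\mathcal B$. *)

theory Defs
  imports "Graph_Theory.Graph_Theory" "HOL-Library.Ramsey"
begin

text \<open>
  A finite simple graph is a \<open>pair_graph\<close>: a finite, loop-free, symmetric digraph without
  parallel arcs, so that an undirected edge \<open>{u, v}\<close> is the pair of arcs \<open>(u, v)\<close>, \<open>(v, u)\<close>.
\<close>

definition edges :: "'a pair_pre_digraph \<Rightarrow> 'a set set" where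
  "edges G = {{u, v} | u v. (u, v) \<in> parcs G}"

definition stability_number :: "'a pair_pre_digraph \<Rightarrow> nat" where
  "stability_number G = Max {card S | S. S \<subseteq> pverts G \<and> indep S (edges G)}"

definition clique_number :: "'a pair_pre_digraph \<Rightarrow> nat" where
  "clique_number G = Max {card K | K. K \<subseteq> pverts G \<and> clique K (edges G)}"

definition complement :: "'a pair_pre_digraph \<Rightarrow> 'a pair_pre_digraph" where
  "complement G =
    \<lparr> pverts = pverts G,
      parcs = {(u, v). u \<in> pverts G \<and> v \<in> pverts G \<and> u \<noteq> v \<and> (u, v) \<notin> parcs G} \<rparr>"

definition bipartite :: "'a pair_pre_digraph \<Rightarrow> bool" where
  "bipartite G \<longleftrightarrow>
    (\<exists>X Y. pverts G = X \<union> Y \<and> X \<inter> Y = {} \<and> parcs G \<subseteq> X \<times> Y \<union> Y \<times> X)"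

definition perfect_matching :: "'a pair_pre_digraph \<Rightarrow> 'a set set \<Rightarrow> bool" where
  "perfect_matching G M \<longleftrightarrow> M \<subseteq> edges G \<and> (\<forall>v \<in> pverts G. \<exists>!e. e \<in> M \<and> v \<in> e)"

definition bipartite_six_pm :: "'a pair_pre_digraph set" where
  "bipartite_six_pm =
    {H. pair_graph H \<and> card (pverts H) = 6 \<and> bipartite H \<and> (\<exists>M. perfect_matching H M)}"

definition class_B :: "'a pair_pre_digraph set" where
  "class_B = bipartite_six_pm \<union> complement ` bipartite_six_pm"

text \<open>
  The members of \<open>class_B\<close> matter only up to isomorphism, and every finite graph has an
  isomorphic copy on natural numbers; hence the vertex type \<^typ>\<open>nat\<close> for \<open>F\<close>.
\<close>

definition B_free :: "'a pair_pre_digraph \<Rightarrow> bool" where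
  "B_free G \<longleftrightarrow>
    \<not> (\<exists>H F. induced_subgraph (with_proj H) (with_proj G) \<and>
        F \<in> (class_B :: nat pair_pre_digraph set) \<and>
        digraph_iso (with_proj H) (with_proj F))"

end

theory Submission
  imports Defs
begin

text \<open>
  Call two disjoint stable triples linked if a perfect matching joins them. A linked pair induces
  a bipartite graph on six vertices with a perfect matching, so a \<open>\<B>\<close>-free graph contains no
  linked pair, and neither does its complement. Taken together, these two conditions are symmetric
  under complementation.

  Let \<open>S\<close> be a maximum stable set. By Hall's theorem every stable set outside \<open>S\<close> can be matched
  into \<open>S\<close>, for otherwise part of \<open>S\<close> could be exchanged for a larger stable set. Hence the
  vertices outside \<open>S\<close> contain no stable triple (\<open>card_indep_outside_le_2\<close>); by complementation,
  the vertices outside a maximum clique contain no triangle. This applies to every maximum stable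
  set and every maximum clique, and the proof consists in choosing good ones.

  Take a counterexample with as few vertices as possible, so that \<open>n = \<alpha> + \<omega> + 2\<close>. Deleting a
  vertex changes neither \<open>\<alpha>\<close> nor \<open>\<omega>\<close>, so every vertex is missed by some maximum stable set and by
  some maximum clique. Passing to the complement if needed, let \<open>\<omega> \<le> \<alpha>\<close>. If \<open>\<alpha> \<le> 2\<close>, there are at
  most five vertices because \<open>R(3,3) \<le> 6\<close>; then \<open>\<omega> \<le> 1\<close>, so there are no edges and \<open>\<alpha> = n\<close>, which
  is absurd. If \<open>\<alpha> \<ge> 3\<close>, any two maximum stable sets share all but at most two of their vertices.
  Since no vertex lies in all of them, one of them, \<open>S\<close>, is such that each \<open>s \<in> S\<close> has a private
  neighbour \<open>f s\<close>: a vertex outside \<open>S\<close> with \<open>s\<close> as its only neighbour in \<open>S\<close>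
  (\<open>ex_max_indep_all_private\<close>). Exchanging \<open>s\<close> for \<open>f s\<close> gives further maximum stable sets, and
  the absence of stable triples outside them makes the private neighbours pairwise adjacent
  (\<open>private_neighbours_clique\<close>). They form a clique of size \<open>\<alpha> \<ge> \<omega>\<close>, which is therefore maximum,
  and exactly two vertices remain. A short analysis of how two further vertices attach to \<open>S\<close> and
  to \<open>f ` S\<close> excludes them (\<open>no_two_further_vertices\<close>).
\<close>

section \<open>Maximum stable sets\<close>

text \<open>
  A graph is a vertex set \<open>V\<close> together with any set \<open>E\<close> of vertex sets; \<open>x\<close> and \<open>y\<close> are adjacent
  if \<open>{x, y} \<in> E\<close>. The complement of the graph is then simply \<open>- E\<close>, so that every result on
  stable sets yields one on cliques.
\<close>

lemma indep_compl [simp]: "indep X (- E) \<longleftrightarrow> clique X E"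
  by (simp add: indep_def clique_def)

lemma clique_compl [simp]: "clique X (- E) \<longleftrightarrow> indep X E"
  by (simp add: indep_def clique_def)

definition max_indep :: "'a set \<Rightarrow> 'a set set \<Rightarrow> 'a set \<Rightarrow> bool" where
  "max_indep V E S \<longleftrightarrow> S \<subseteq> V \<and> indep S E \<and> (\<forall>T\<subseteq>V. indep T E \<longrightarrow> card T \<le> card S)"

lemma max_indepD:
  assumes "max_indep V E S"
  shows "S \<subseteq> V" "indep S E" "T \<subseteq> V \<Longrightarrow> indep T E \<Longrightarrow> card T \<le> card S"
  using assms by (auto simp: max_indep_def)

lemma max_indep_not_adjacent:
  assumes "max_indep V E S" "x \<in> S" "y \<in> S" "x \<noteq> y"
  shows "{x, y} \<notin> E"
  using max_indepD(2)[OF assms(1)] assms(2-4) by (simp add: indep_def)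

lemma max_indep_card_eq: "max_indep V E S \<Longrightarrow> max_indep V E T \<Longrightarrow> card S = card T"
  by (simp add: max_indep_def order_antisym)

lemma max_indepI_card:
  assumes "max_indep V E S" "T \<subseteq> V" "indep T E" "card S \<le> card T"
  shows "max_indep V E T"
  using assms unfolding max_indep_def by (meson order_trans)

lemma max_indep_exists:
  assumes "finite V"
  shows "\<exists>S. max_indep V E S"
proof -
  have "\<exists>S. (S \<subseteq> V \<and> indep S E) \<and> (\<forall>T. T \<subseteq> V \<and> indep T E \<longrightarrow> card T \<le> card S)"
    by (rule ex_has_greatest_nat[where b = "Suc (card V)" and k = "{}"])
       (auto simp: card_mono assms less_Suc_eq_le)
  then show ?thesis
    by (auto simp: max_indep_def)
qed

lemma max_indep_card_Diff_commute:
  assumes "finite V" "max_indep V E S" "max_indep V E T"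
  shows "card (S - T) = card (T - S)"
proof -
  have "finite S" "finite T"
    using assms by (auto simp: max_indep_def intro: finite_subset)
  then show ?thesis
    using max_indep_card_eq[OF assms(2,3)] card_le_sym_Diff[of S T] card_le_sym_Diff[of T S] by simp
qed

text \<open>
  This is Hall's condition for stable sets outside a maximum stable set: replacing the neighbours
  of \<open>X\<close> in \<open>S\<close> by \<open>X\<close> itself gives a stable set, which is not larger than \<open>S\<close>.
\<close>

lemma card_outside_le_neighbours:
  assumes "finite V" "max_indep V E S" "X \<subseteq> V - S" "indep X E"
  shows "card X \<le> card {s\<in>S. \<exists>x\<in>X. {s, x} \<in> E}"
proof -
  let ?N = "{s\<in>S. \<exists>x\<in>X. {s, x} \<in> E}"
  have fin: "finite S" "finite X"
    using assms by (auto simp: max_indep_def intro: finite_subset)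
  have "indep ((S - ?N) \<union> X) E"
  proof -
    have "{s, x} \<notin> E \<and> {x, s} \<notin> E" if "s \<in> S - ?N" "x \<in> X" for s x
      using that by (auto simp: insert_commute)
    moreover have "indep S E" using assms(2) by (rule max_indepD)
    ultimately show ?thesis
      using assms(4) unfolding indep_def by blast
  qed
  moreover have "(S - ?N) \<union> X \<subseteq> V"
    using assms(2,3) by (auto simp: max_indep_def)
  ultimately have "card ((S - ?N) \<union> X) \<le> card S"
    using assms(2) by (auto simp: max_indep_def)
  moreover have "card ((S - ?N) \<union> X) = card (S - ?N) + card X"
    using fin assms(3) by (intro card_Un_disjoint) auto
  moreover have "card (S - ?N) = card S - card ?N"
    using fin by (intro card_Diff_subset) auto
  moreover have "card ?N \<le> card S"
    using fin by (auto intro: card_mono)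
  ultimately show ?thesis
    by linarith
qed

lemma outside_has_neighbour:
  assumes "finite V" "max_indep V E S" "t \<in> V - S"
  obtains s where "s \<in> S" "{s, t} \<in> E"
proof -
  have "card {t} \<le> card {s\<in>S. \<exists>x\<in>{t}. {s, x} \<in> E}"
    using assms by (intro card_outside_le_neighbours) (auto simp: indep_def)
  then have "{s\<in>S. \<exists>x\<in>{t}. {s, x} \<in> E} \<noteq> {}"
    by (metis card.empty card_eq_0_iff finite.emptyI finite_insert insert_not_empty le_zero_eq)
  then show ?thesis
    using that by auto
qed

section \<open>Graphs without linked triples\<close>

text \<open>
  Hall's marriage theorem for three sets. If distinct \<open>a \<in> A\<close> and \<open>b \<in> B\<close> leave nothing in \<open>C\<close>,
  then \<open>C \<subseteq> {a, b}\<close>; a third element \<open>z\<close> of \<open>A \<union> B\<close> then replaces one of the two, and the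
  condition on pairs of sets settles the case that \<open>C\<close> is a singleton.
\<close>

lemma three_representatives:
  assumes "A \<noteq> {}" "B \<noteq> {}" "C \<noteq> {}"
    and "card (A \<union> B) \<ge> 2" "card (A \<union> C) \<ge> 2" "card (B \<union> C) \<ge> 2" "card (A \<union> B \<union> C) \<ge> 3"
  obtains a b c where "a \<in> A" "b \<in> B" "c \<in> C" "distinct [a, b, c]"
proof -
  have two: "\<exists>y\<in>X. y \<noteq> x" if "card X \<ge> 2" for X :: "'a set" and x
  proof -
    have "\<not> X \<subseteq> {x}"
      using that card_mono[of "{x}" X] by auto
    then show ?thesis by auto
  qed
  have three: "\<exists>z\<in>X. z \<noteq> x \<and> z \<noteq> y" if "card X \<ge> 3" for X :: "'a set" and x y
  proof -
    have "\<not> X \<subseteq> {x, y}"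
      using that card_mono[of "{x, y}" X] card_insert_le_m1[of 2 "{y}" x] by auto
    then show ?thesis by auto
  qed
  obtain a b where ab: "a \<in> A" "b \<in> B" "a \<noteq> b"
    using assms(1,2) two[OF assms(4)] by (metis Un_iff ex_in_conv)
  show ?thesis
  proof (cases "C \<subseteq> {a, b}")
    case False
    then show ?thesis using that ab by auto
  next
    case True
    obtain z where z: "z \<in> A \<union> B \<union> C" "z \<noteq> a" "z \<noteq> b"
      using three[OF assms(7)] by blast
    then consider "z \<in> A" | "z \<in> B"
      using True by auto
    then show ?thesis
    proof cases
      case 1
      show ?thesis
      proof (cases "a \<in> C")
        case True
        then show ?thesis using that[of z b a] ab z 1 by auto
      next
        case False
        then have C: "C = {b}" using True assms(3) by auto
        then obtain b' where "b' \<in> B" "b' \<noteq> b"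
          using two[OF assms(6), of b] by auto
        then show ?thesis
          using that[of z b' b] that[of a b' b] ab z 1 C by (cases "b' = z") auto
      qed
    next
      case 2
      show ?thesis
      proof (cases "b \<in> C")
        case True
        then show ?thesis using that[of a z b] ab z 2 by auto
      next
        case False
        then have C: "C = {a}" using True assms(3) by auto
        then obtain a' where "a' \<in> A" "a' \<noteq> a"
          using two[OF assms(5), of a] by auto
        then show ?thesis
          using that[of a' z a] that[of a' b a] ab z 2 C by (cases "a' = z") auto
      qed
    qed
  qed
qed

text \<open>
  The triples are the two halves of a list, listed so that the matching joins entries at distance
  three. The order makes the list usable as a numbering of the six vertices.
\<close>

definition linked_triples :: "'a set set \<Rightarrow> 'a list \<Rightarrow> bool" where
  "linked_triples E p \<longleftrightarrow> (\<exists>x y z x' y' z'. p = [x, y, z, x', y', z'] \<and> distinct p \<and>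
     indep {x, y, z} E \<and> indep {x', y', z'} E \<and> {x, x'} \<in> E \<and> {y, y'} \<in> E \<and> {z, z'} \<in> E)"

locale linkage_free =
  fixes V :: "'a set" and E :: "'a set set"
  assumes finite_V: "finite V"
    and no_linked_triples: "set p \<subseteq> V \<Longrightarrow> \<not> linked_triples E p"
begin

text \<open>
  Three independent vertices outside \<open>S\<close> would satisfy Hall's condition, and hence be matched to
  three vertices of \<open>S\<close>; the two triples would be linked.
\<close>

lemma card_indep_outside_le_2:
  assumes S: "max_indep V E S" and X: "X \<subseteq> V - S" "indep X E"
  shows "card X \<le> 2"
proof (rule ccontr)
  assume "\<not> card X \<le> 2"
  then obtain Y where "Y \<subseteq> X" "card Y = 3"
    using obtain_subset_with_card_n[of 3 X] by auto
  then obtain x y z where Y: "Y = {x, y, z}" "x \<noteq> y" "x \<noteq> z" "y \<noteq> z"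
    by (auto simp: card_3_iff)
  have sub: "{x, y, z} \<subseteq> V - S" and ind: "indep {x, y, z} E"
    using Y \<open>Y \<subseteq> X\<close> X smaller_indep by blast+
  define N where "N v = {s\<in>S. {s, v} \<in> E}" for v
  have N: "card Z \<le> card (\<Union>v\<in>Z. N v)" if "Z \<subseteq> {x, y, z}" for Z
  proof -
    have "(\<Union>v\<in>Z. N v) = {s\<in>S. \<exists>v\<in>Z. {s, v} \<in> E}"
      by (auto simp: N_def)
    then show ?thesis
      using card_outside_le_neighbours[OF finite_V S, of Z] that sub smaller_indep[OF ind that]
      by auto
  qed
  have ne: "N v \<noteq> {}" if "v \<in> {x, y, z}" for v
    using N[of "{v}"] that by auto
  have 2: "2 \<le> card (N x \<union> N y)" "2 \<le> card (N x \<union> N z)" "2 \<le> card (N y \<union> N z)"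
    and 3: "3 \<le> card (N x \<union> N y \<union> N z)"
    using N[of "{x, y}"] N[of "{x, z}"] N[of "{y, z}"] N[of "{x, y, z}"] Y
    by (auto simp: Un_assoc)
  obtain a b c where abc: "a \<in> N x" "b \<in> N y" "c \<in> N z" "distinct [a, b, c]"
    using three_representatives[of "N x" "N y" "N z"] ne 2 3 by auto
  have "{a, b, c} \<subseteq> S"
    using abc by (auto simp: N_def)
  moreover from this have "indep {a, b, c} E"
    using max_indepD(2)[OF S] smaller_indep by blast
  ultimately have "linked_triples E [a, b, c, x, y, z]"
    using abc sub ind Y by (auto simp: linked_triples_def N_def)
  moreover have "set [a, b, c, x, y, z] \<subseteq> V"
    using sub \<open>{a, b, c} \<subseteq> S\<close> S by (auto simp: max_indep_def)
  ultimately show False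
    using no_linked_triples by blast
qed

lemma no_indep_triple_outside:
  assumes "max_indep V E S" "x \<in> V - S" "y \<in> V - S" "z \<in> V - S"
    and "x \<noteq> y" "x \<noteq> z" "y \<noteq> z" "{x, y} \<notin> E" "{x, z} \<notin> E" "{y, z} \<notin> E"
  shows False
  using card_indep_outside_le_2[OF assms(1), of "{x, y, z}"] assms
  by (auto simp: indep_def insert_commute)

lemma card_Diff_max_indep_le_2:
  assumes "max_indep V E S" "max_indep V E T"
  shows "card (S - T) \<le> 2"
proof (rule card_indep_outside_le_2[OF assms(2)])
  show "S - T \<subseteq> V - T" using max_indepD(1)[OF assms(1)] by blast
  show "indep (S - T) E" by (rule smaller_indep[OF max_indepD(2)[OF assms(1)]]) blast
qed

text \<open>
  The point of a private neighbour \<open>t\<close> of \<open>s\<close> is that exchanging \<open>s\<close> for \<open>t\<close> turns a maximum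
  stable set into another one.
\<close>

definition private_neighbour :: "'a set \<Rightarrow> 'a \<Rightarrow> 'a \<Rightarrow> bool" where
  "private_neighbour S s t \<longleftrightarrow> s \<in> S \<and> t \<in> V - S \<and> (\<forall>x\<in>S. {x, t} \<in> E \<longleftrightarrow> x = s)"

lemma max_indep_swap_private:
  assumes S: "max_indep V E S" and t: "private_neighbour S s t"
  shows "max_indep V E (insert t (S - {s}))"
proof (rule max_indepI_card[OF S])
  show "insert t (S - {s}) \<subseteq> V"
    using S t by (auto simp: private_neighbour_def max_indep_def)
  show "indep (insert t (S - {s})) E"
    using S t by (auto simp: private_neighbour_def max_indep_def indep_def insert_commute)
  have "finite S"
    using S finite_V by (auto simp: max_indep_def intro: finite_subset)
  then show "card S \<le> card (insert t (S - {s}))"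
    using t by (simp add: private_neighbour_def card.remove)
qed

text \<open>
  The single vertex of \<open>T - S\<close> has some neighbour in \<open>S\<close>, as \<open>S\<close> is maximum, and none in \<open>T\<close>;
  only \<open>s\<close> is left.
\<close>

lemma private_neighbour_if_Diff_singleton:
  assumes S: "max_indep V E S" and T: "max_indep V E T" and diff: "S - T = {s}"
  shows "\<exists>t. private_neighbour S s t"
proof -
  have "card (T - S) = 1"
    using max_indep_card_Diff_commute[OF finite_V S T] diff by simp
  then obtain t where t: "T - S = {t}"
    by (auto simp: card_1_singleton_iff)
  then have tV: "t \<in> V - S"
    using T by (auto simp: max_indep_def)
  have only: "x = s" if "x \<in> S" "{x, t} \<in> E" for x
  proof (rule ccontr)
    assume "x \<noteq> s"
    then have "x \<in> T" using that diff by auto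
    moreover have "t \<in> T" "x \<noteq> t" using t \<open>x \<in> S\<close> by auto
    ultimately show False
      using max_indep_not_adjacent[OF T] that(2) by blast
  qed
  obtain s' where "s' \<in> S" "{s', t} \<in> E"
    using outside_has_neighbour[OF finite_V S tV] .
  then have "private_neighbour S s t"
    using only tV by (auto simp: private_neighbour_def)
  then show ?thesis ..
qed

section \<open>The structure of a minimal counterexample\<close>

text \<open>
  Suppose \<open>a \<in> S\<close> has no private neighbour. A maximum stable set \<open>S1\<close> missing \<open>a\<close> then omits
  exactly two vertices \<open>a\<close>, \<open>b\<close> of \<open>S\<close>. For any other \<open>c \<in> S\<close>, let \<open>T\<close> be a maximum stable set
  missing \<open>c\<close>. As \<open>S1 - T\<close> contains \<open>c\<close> and has at most two elements, \<open>S1\<close> and \<open>T\<close> share a vertex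
  \<open>t\<close> outside \<open>S\<close>. The neighbours of \<open>t\<close> in \<open>S\<close> are missed by both sets, so they are among \<open>a\<close>
  and \<open>b\<close>. They are not both, since \<open>S - T\<close> has at most two elements and contains \<open>c\<close>, and not
  \<open>a\<close> alone, by the choice of \<open>a\<close>. Hence \<open>t\<close> is a private neighbour of \<open>b\<close>, and \<open>S - T = {b, c}\<close>.
  The vertex \<open>t\<close> is the same for all \<open>c\<close>, because the other vertex of \<open>S1 - S\<close> is adjacent to
  \<open>a\<close>. So after exchanging \<open>b\<close> for \<open>t\<close>, each of these sets differs from the new set in one vertex
  only.
\<close>

lemma ex_max_indep_all_private:
  assumes S: "max_indep V E S" and big: "3 \<le> card S"
    and avoid: "\<And>v. v \<in> V \<Longrightarrow> \<exists>T. max_indep V E T \<and> v \<notin> T"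
  shows "\<exists>T. max_indep V E T \<and> (\<forall>s\<in>T. \<exists>t. private_neighbour T s t)"
proof (cases "\<forall>s\<in>S. \<exists>t. private_neighbour S s t")
  case True
  then show ?thesis using S by blast
next
  case False
  then obtain a where a: "a \<in> S" "\<nexists>t. private_neighbour S a t"
    by blast
  have fin: "finite T" if "max_indep V E T" for T
    using that finite_V by (auto simp: max_indep_def intro: finite_subset)
  have SV: "S \<subseteq> V" using S by (rule max_indepD)
  then obtain S1 where S1: "max_indep V E S1" "a \<notin> S1"
    using avoid a by blast
  have "S - S1 \<noteq> {a}"
    using private_neighbour_if_Diff_singleton[OF S S1(1)] a(2) by blast
  moreover have aS1: "a \<in> S - S1" using a(1) S1(2) by blast
  ultimately have "card (S - S1) \<noteq> 1"
    by (metis card_1_singletonE singletonD)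
  moreover have "card (S - S1) \<noteq> 0"
    using fin[OF S] aS1 by auto
  ultimately have card1: "card (S - S1) = 2"
    using card_Diff_max_indep_le_2[OF S S1(1)] by linarith
  then obtain x y where "S - S1 = {x, y}" "x \<noteq> y"
    by (auto simp: card_2_iff)
  then obtain b where b: "S - S1 = {a, b}" "a \<noteq> b"
    using aS1 by (metis insert_commute insertE singletonD)
  have card1': "card (S1 - S) = 2"
    using card1 max_indep_card_Diff_commute[OF finite_V S S1(1)] by simp
  have key: "\<exists>T t. max_indep V E T \<and> c \<notin> T \<and> t \<in> S1 \<and> t \<in> T \<and> private_neighbour S b t \<and> S - T = {b, c}"
    if c: "c \<in> S" "c \<noteq> a" "c \<noteq> b" for c
  proof -
    obtain T where T: "max_indep V E T" "c \<notin> T"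
      using avoid c SV by blast
    \<comment> \<open>Otherwise \<open>S1 - T\<close> contains \<open>c\<close> and both vertices of \<open>S1 - S\<close>.\<close>
    have "\<not> (S1 - S) \<inter> T = {}"
    proof
      assume "(S1 - S) \<inter> T = {}"
      then have "insert c (S1 - S) \<subseteq> S1 - T"
        using c b T by auto
      then have "card (insert c (S1 - S)) \<le> card (S1 - T)"
        using fin[OF S1(1)] by (intro card_mono) auto
      then show False
        using card1' c fin[OF S1(1)] card_Diff_max_indep_le_2[OF S1(1) T(1)] by simp
    qed
    then obtain t where t: "t \<in> S1" "t \<notin> S" "t \<in> T" by auto
    have tV: "t \<in> V - S" using t S1 by (auto simp: max_indep_def)
    have nb: "x \<in> {a, b} \<and> x \<notin> T" if "x \<in> S" "{x, t} \<in> E" for x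
    proof -
      have "x \<noteq> t" using that t by blast
      then have "x \<notin> S1" "x \<notin> T"
        using max_indep_not_adjacent[OF S1(1)] max_indep_not_adjacent[OF T(1)] t that(2) by blast+
      then show ?thesis using that b by blast
    qed
    obtain x where x: "x \<in> S" "{x, t} \<in> E"
      using outside_has_neighbour[OF finite_V S tV] .
    have le2: "card (S - T) \<le> 2"
      using card_Diff_max_indep_le_2[OF S T(1)] .
    have "\<not> {a, b, c} \<subseteq> S - T"
    proof
      assume "{a, b, c} \<subseteq> S - T"
      then have "card {a, b, c} \<le> 2"
        using card_mono[OF _ \<open>{a, b, c} \<subseteq> S - T\<close>] fin[OF S] le2 by auto
      then show False using b c by auto
    qed
    then have "\<not> ({a, t} \<in> E \<and> {b, t} \<in> E)"
      using nb[of a] nb[of b] a(1) b c T(2) by blast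
    moreover have "{b, t} \<in> E"
    proof (rule ccontr)
      assume "{b, t} \<notin> E"
      then have only: "y = a" if "y \<in> S" "{y, t} \<in> E" for y
        using nb[OF that] that(2) by blast
      then have "{a, t} \<in> E" using x by blast
      then have "private_neighbour S a t"
        using only tV a(1) unfolding private_neighbour_def by blast
      then show False using a by blast
    qed
    moreover from calculation have "y = b" if "y \<in> S" "{y, t} \<in> E" for y
      using nb[OF that] that(2) by blast
    ultimately have "private_neighbour S b t"
      using tV b(1) unfolding private_neighbour_def by blast
    moreover have "S - T = {b, c}"
    proof (rule card_seteq[symmetric])
      show "{b, c} \<subseteq> S - T"
        using nb[of b] \<open>{b, t} \<in> E\<close> b c T by auto
    qed (use fin[OF S] le2 c in auto)
    ultimately show ?thesis using T t by blast
  qed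
  have "\<not> S \<subseteq> {a, b}"
    using big card_mono[of "{a, b}" S] b by auto
  then obtain c0 where "c0 \<in> S" "c0 \<noteq> a" "c0 \<noteq> b"
    by auto
  from key[OF this] obtain t where t: "t \<in> S1" "private_neighbour S b t"
    by blast
  \<comment> \<open>The second vertex of \<open>S1 - S\<close> sees \<open>a\<close>, so it is no private neighbour of \<open>b\<close>.\<close>
  obtain q where q: "q \<in> S1" "{q, a} \<in> E"
    using outside_has_neighbour[OF finite_V S1(1)] a SV S1(2) by blast
  have "q \<notin> S"
    using max_indep_not_adjacent[OF S, of q a] q a(1) S1(2) by blast
  have not_q: "u \<noteq> q" if "private_neighbour S b u" for u
    using that q a(1) b(2) by (auto simp: private_neighbour_def insert_commute)
  have S1S: "S1 - S = {t, q}"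
  proof (rule card_seteq[symmetric])
    show "{t, q} \<subseteq> S1 - S"
      using t q \<open>q \<notin> S\<close> by (auto simp: private_neighbour_def)
  qed (use fin[OF S1(1)] card1' not_q[OF t(2)] in auto)
  define S' where "S' = insert t (S - {b})"
  have S': "max_indep V E S'"
    unfolding S'_def by (rule max_indep_swap_private[OF S t(2)])
  have "\<exists>u. private_neighbour S' s u" if s: "s \<in> S'" for s
  proof -
    consider "s = t" | "s = a" | "s \<in> S" "s \<noteq> a" "s \<noteq> b"
      using s by (auto simp: S'_def)
    then show ?thesis
    proof cases
      case 1
      have "private_neighbour S' t b"
        using t(2) SV max_indep_not_adjacent[OF S, of _ b]
        by (auto simp: private_neighbour_def S'_def insert_commute)
      then show ?thesis using 1 by blast
    next
      case 2
      have "S' - S1 = {a}"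
        using b t(1) a(1) by (auto simp: S'_def)
      then show ?thesis
        using private_neighbour_if_Diff_singleton[OF S' S1(1)] 2 by blast
    next
      case 3
      from key[OF this] obtain T u where T: "max_indep V E T" "s \<notin> T" "u \<in> S1" "u \<in> T"
        "private_neighbour S b u" "S - T = {b, s}"
        by blast
      then have "u = t"
        using S1S not_q by (auto simp: private_neighbour_def)
      then have "S' - T = {s}"
        using T 3 by (auto simp: S'_def)
      then show ?thesis
        using private_neighbour_if_Diff_singleton[OF S' T(1)] by blast
    qed
  qed
  then show ?thesis using S' by blast
qed

text \<open>
  For a third \<open>k \<in> S\<close>, exchange \<open>k\<close> for \<open>f k\<close>. The vertices \<open>k\<close>, \<open>f i\<close>, \<open>f j\<close> lie outside the new
  maximum stable set and \<open>k\<close> is adjacent to neither \<open>f i\<close> nor \<open>f j\<close>, which must therefore be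
  adjacent.
\<close>

lemma private_neighbours_clique:
  assumes S: "max_indep V E S" and big: "3 \<le> card S"
    and f: "\<And>s. s \<in> S \<Longrightarrow> private_neighbour S s (f s)"
  shows "clique (f ` S) E" "inj_on f S"
proof -
  show inj: "inj_on f S"
    using f unfolding inj_on_def private_neighbour_def by metis
  have "{f i, f j} \<in> E" if ij: "i \<in> S" "j \<in> S" "i \<noteq> j" for i j
  proof (rule ccontr)
    assume no: "{f i, f j} \<notin> E"
    have "\<not> S \<subseteq> {i, j}"
      using big card_mono[of "{i, j}" S] ij by auto
    then obtain k where k: "k \<in> S" "k \<noteq> i" "k \<noteq> j"
      by auto
    note S' = max_indep_swap_private[OF S f[OF k(1)]]
    have "f i \<noteq> f j" "f i \<noteq> f k" "f j \<noteq> f k"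
      using inj ij k by (auto simp: inj_on_def)
    moreover have "k \<noteq> f k" "k \<in> V"
      using f[OF k(1)] k(1) max_indepD(1)[OF S] by (auto simp: private_neighbour_def)
    ultimately show False
      using no_indep_triple_outside[OF S', of k "f i" "f j"] f[OF ij(1)] f[OF ij(2)] k ij no
      by (auto simp: private_neighbour_def)
  qed
  then show "clique (f ` S) E"
    by (auto simp: clique_def)
qed

end

lemma linkage_free_mono:
  assumes "linkage_free V E" "W \<subseteq> V"
  shows "linkage_free W E"
  using assms by (auto simp: linkage_free_def intro: finite_subset)

text \<open>
  Let \<open>r\<close> be a vertex outside \<open>S\<close> and \<open>f ` S\<close>. If \<open>r\<close> is not adjacent to \<open>i \<in> S\<close>, then \<open>r\<close> is
  adjacent to \<open>f j\<close> for all \<open>j \<noteq> i\<close>, as \<open>i\<close>, \<open>r\<close>, \<open>f j\<close> lie outside the maximum stable set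
  obtained by exchanging \<open>i\<close> for \<open>f i\<close>. But \<open>r\<close> is not adjacent to all of the maximum clique
  \<open>f ` S\<close>. Hence \<open>r\<close> misses at most one vertex of \<open>S\<close>, and it is adjacent to \<open>i\<close> whenever it is
  adjacent to \<open>f i\<close>.

  If \<open>p\<close> and \<open>q\<close> are adjacent, a common neighbour in \<open>S\<close> completes a triangle outside the maximum
  clique. If they are not, each vertex of \<open>f ` S\<close> is adjacent to \<open>p\<close> or \<open>q\<close> but neither is
  adjacent to all, so that there are \<open>i \<noteq> j\<close> for which \<open>p\<close>, \<open>f j\<close>, \<open>j\<close> and \<open>q\<close>, \<open>i\<close>, \<open>f i\<close> are
  triangles. In the complement they are linked in this order.
\<close>

lemma no_two_further_vertices:
  assumes "linkage_free V E" and co: "linkage_free V (- E)"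
    and S: "max_indep V E S" and big: "3 \<le> card S"
    and f: "\<And>s. s \<in> S \<Longrightarrow> linkage_free.private_neighbour V E S s (f s)"
    and T: "max_indep V (- E) (f ` S)"
    and r: "p \<in> V - S - f ` S" "q \<in> V - S - f ` S" "p \<noteq> q"
  shows False
proof -
  interpret linkage_free V E by fact
  interpret co: linkage_free V "- E" by fact
  have inj: "inj_on f S"
    using private_neighbours_clique(2)[OF S big, of f] f by simp
  have SV: "S \<subseteq> V" using S by (rule max_indepD)
  have edge: "{x, f s} \<in> E \<longleftrightarrow> x = s" if "x \<in> S" "s \<in> S" for x s
    using f[OF that(2)] that by (auto simp: private_neighbour_def)
  have fS: "f s \<in> V - S" if "s \<in> S" for s
    using f[OF that] by (auto simp: private_neighbour_def)
  have to_T: "{r, f j} \<in> E" if "r \<in> V - S - f ` S" "i \<in> S" "{r, i} \<notin> E" "j \<in> S" "j \<noteq> i" for r i j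
  proof (rule ccontr)
    assume no: "{r, f j} \<notin> E"
    note S' = max_indep_swap_private[OF S f[OF that(2)]]
    have "f j \<noteq> f i" using inj that by (auto simp: inj_on_def)
    moreover have "i \<noteq> r" "r \<noteq> f i" "r \<noteq> f j" "i \<noteq> f i" "i \<noteq> f j"
      using that fS[of j] fS[of i] by auto
    ultimately show False
      using no_indep_triple_outside[OF S', of i r "f j"] that no edge[of i j] fS[of j] fS[of i] SV
      by (auto simp: insert_commute[of i r "{}"])
  qed
  have miss_T: "\<exists>i\<in>S. {r, f i} \<notin> E" if "r \<in> V - S - f ` S" for r
    using outside_has_neighbour[OF finite_V T, of r] that
    by (metis ComplD Diff_iff imageE insert_commute)
  have adj_S: "{r, i} \<in> E" if "r \<in> V - S - f ` S" "i \<in> S" "{r, f i} \<in> E" for r i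
    using to_T[OF that(1,2)] miss_T[OF that(1)] that(3) by metis
  show False
  proof (cases "{p, q} \<in> E")
    case True
    have "\<exists>s\<in>S. {p, s} \<in> E \<and> {q, s} \<in> E"
    proof (rule ccontr)
      assume none: "\<not> ?thesis"
      have one: "i = j" if "r \<in> V - S - f ` S" "i \<in> S" "j \<in> S" "{r, i} \<notin> E" "{r, j} \<notin> E" for r i j
        using to_T[OF that(1,2,4)] to_T[OF that(1,3,5)] miss_T[OF that(1)] by metis
      have "\<exists>i j. S \<subseteq> {i, j}"
      proof -
        have "\<forall>s\<in>S. {p, s} \<notin> E \<or> {q, s} \<notin> E" using none by blast
        then show ?thesis
          using one[OF r(1)] one[OF r(2)] by (smt (verit, best) insertCI subsetI)
      qed
      then obtain i j where "S \<subseteq> {i, j}" by blast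
      then have "card S \<le> card {i, j}"
        by (intro card_mono) auto
      also have "\<dots> \<le> 2" by (simp add: card_insert_if)
      finally show False using big by simp
    qed
    then obtain s where "s \<in> S" "{p, s} \<in> E" "{q, s} \<in> E" by blast
    then show False
      using co.no_indep_triple_outside[OF T, of p q s] r True SV fS by auto
  next
    case False
    obtain i where i: "i \<in> S" "{p, f i} \<notin> E" using miss_T[OF r(1)] by blast
    obtain j where j: "j \<in> S" "{q, f j} \<notin> E" using miss_T[OF r(2)] by blast
    have either: "{p, f s} \<in> E \<or> {q, f s} \<in> E" if "s \<in> S" for s
      using no_indep_triple_outside[OF S, of p q "f s"] r False fS[OF that] that by auto
    have qi: "{q, f i} \<in> E" and pj: "{p, f j} \<in> E"
      using either i j by blast+
    then have ij: "i \<noteq> j" using i by auto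
    have "clique {p, f j, j} E"
      using pj adj_S[OF r(1) j(1) pj] edge[OF j(1) j(1)] by (auto simp: clique_def insert_commute)
    moreover have "clique {q, i, f i} E"
      using qi adj_S[OF r(2) i(1) qi] edge[OF i(1) i(1)] by (auto simp: clique_def insert_commute)
    moreover have "{f j, i} \<notin> E" "{j, f i} \<notin> E"
      using edge[OF i(1) j(1)] edge[OF j(1) i(1)] ij by (auto simp: insert_commute)
    moreover have "f i \<noteq> f j" using inj i(1) j(1) ij by (auto simp: inj_on_def)
    then have "distinct [p, f j, j, q, i, f i]"
      using r fS[OF i(1)] fS[OF j(1)] i(1) j(1) ij by auto
    ultimately have "linked_triples (- E) [p, f j, j, q, i, f i]"
      using False by (simp add: linked_triples_def)
    moreover have "set [p, f j, j, q, i, f i] \<subseteq> V"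
      using r i(1) j(1) fS SV by auto
    ultimately show False
      using co.no_linked_triples by blast
  qed
qed

text \<open>
  The bound \<open>R(3,3) \<le> 6\<close>: a vertex has three neighbours or three non-neighbours, and three
  neighbours either are stable or contain an edge that forms a triangle with the vertex.
\<close>

lemma ramsey_3_3:
  assumes "6 \<le> card V"
  shows "\<exists>X\<subseteq>V. card X = 3 \<and> (indep X E \<or> clique X E)"
proof -
  obtain W where W: "W \<subseteq> V" "card W = 6" "finite W"
    by (rule obtain_subset_with_card_n[OF assms])
  have "W \<noteq> {}" using W(2) by auto
  then obtain v where v: "v \<in> W" by blast
  define N where "N F = {w\<in>W - {v}. {v, w} \<in> F}" for F
  have half: "\<exists>X\<subseteq>V. card X = 3 \<and> (indep X F \<or> clique X F)" if big: "3 \<le> card (N F)" for F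
  proof -
    obtain X where X: "X \<subseteq> N F" "card X = 3"
      by (rule obtain_subset_with_card_n[OF big])
    have XV: "X \<subseteq> V" using X(1) W(1) by (auto simp: N_def)
    show ?thesis
    proof (cases "indep X F")
      case True
      then show ?thesis using XV X(2) by blast
    next
      case False
      then obtain x y where xy: "x \<in> X" "y \<in> X" "x \<noteq> y" "{x, y} \<in> F"
        by (auto simp: indep_def)
      then have "{v, x} \<in> F" "{v, y} \<in> F" "v \<noteq> x" "v \<noteq> y"
        using X(1) by (auto simp: N_def)
      then have "clique {v, x, y} F" "card {v, x, y} = 3"
        using xy by (auto simp: clique_def insert_commute)
      then show ?thesis using xy XV v W(1) by (intro exI[of _ "{v, x, y}"]) auto
    qed
  qed
  have "card (N E) + card (N (- E)) = card (N E \<union> N (- E))"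
    using W by (intro card_Un_disjoint[symmetric]) (auto simp: N_def)
  also have "N E \<union> N (- E) = W - {v}" by (auto simp: N_def)
  finally have "card (N E) + card (N (- E)) = 5" using W v by simp
  then consider "3 \<le> card (N E)" | "3 \<le> card (N (- E))" by linarith
  then show ?thesis
  proof cases
    case 1
    then show ?thesis by (rule half)
  next
    case 2
    then show ?thesis using half[of "- E"] by auto
  qed
qed

text \<open>
  The bound on \<open>card V\<close> and the hypothesis \<open>avoid\<close> are what a minimal counterexample provides.
  The hypothesis \<open>card K \<le> card S\<close> makes the clique of private neighbours a maximum one.
\<close>

lemma no_critical_graph:
  assumes free: "linkage_free V E" "linkage_free V (- E)"
    and S: "max_indep V E S" and K: "max_indep V (- E) K"
    and le: "card K \<le> card S" and n: "card S + card K + 2 \<le> card V"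
    and avoid: "\<And>v. v \<in> V \<Longrightarrow> \<exists>T. max_indep V E T \<and> v \<notin> T"
  shows False
proof (cases "3 \<le> card S")
  case True
  interpret linkage_free V E by fact
  obtain T where T: "max_indep V E T" "\<forall>s\<in>T. \<exists>t. private_neighbour T s t"
    using ex_max_indep_all_private[OF S True avoid] by blast
  then obtain f where f: "\<And>s. s \<in> T \<Longrightarrow> private_neighbour T s (f s)"
    by metis
  have ST: "card T = card S" using T S max_indep_card_eq by blast
  have cl: "clique (f ` T) E" "inj_on f T"
    using private_neighbours_clique[of T f] T(1) f True ST by simp_all
  have fV: "f ` T \<subseteq> V" using f by (auto simp: private_neighbour_def)
  have cf: "card (f ` T) = card S" using cl ST by (simp add: card_image)
  have L: "max_indep V (- E) (f ` T)"
    by (rule max_indepI_card[OF K]) (use fV cl cf le in auto)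
  then have "card K = card S" using K cf max_indep_card_eq by metis
  moreover have "card (V - (T \<union> f ` T)) \<ge> card V - card (T \<union> f ` T)"
    using finite_subset[OF _ finite_V, of "T \<union> f ` T"] fV max_indepD(1)[OF T(1)]
    by (intro diff_card_le_card_Diff) auto
  moreover have "card (T \<union> f ` T) \<le> card S + card S"
    using card_Un_le[of T "f ` T"] ST cf by simp
  ultimately have two: "2 \<le> card (V - (T \<union> f ` T))" using n by linarith
  obtain Y where Y: "Y \<subseteq> V - (T \<union> f ` T)" "card Y = 2"
    by (rule obtain_subset_with_card_n[OF two])
  from Y(2) obtain p q where pq: "Y = {p, q}" "p \<noteq> q"
    by (auto simp: card_2_iff)
  show False
  proof (rule no_two_further_vertices[OF free T(1) _ f L _ _ pq(2)])
    show "p \<in> V - T - f ` T" "q \<in> V - T - f ` T"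
      using Y(1) pq(1) by auto
  qed (use True ST in simp_all)
next
  case False
  have "card V < 6"
  proof (rule ccontr)
    assume "\<not> card V < 6"
    then have "6 \<le> card V" by simp
    from ramsey_3_3[OF this, of E]
    obtain X where "X \<subseteq> V" "card X = 3" "indep X E \<or> clique X E"
      by blast
    then show False
      using max_indepD(3)[OF S, of X] max_indepD(3)[OF K, of X] False le by auto
  qed
  then have "card K \<le> 1" using n le by linarith
  have "indep V E"
    unfolding indep_def
  proof (intro ballI impI notI)
    fix x y assume "x \<in> V" "y \<in> V" "x \<noteq> y" "{x, y} \<in> E"
    then have "card {x, y} \<le> card K"
      by (intro max_indepD(3)[OF K]) (auto simp: clique_def insert_commute)
    then show False using \<open>card K \<le> 1\<close> \<open>x \<noteq> y\<close> by simp
  qed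
  then show False using max_indepD(3)[OF S, of V] n by simp
qed

text \<open>
  In a minimal counterexample the bound for \<open>V - {v}\<close> leaves no slack, so a maximum stable set
  and a maximum clique of \<open>V - {v}\<close> are still maximum in \<open>V\<close>, and they miss \<open>v\<close>.
\<close>

theorem card_le_of_linkage_free:
  assumes "linkage_free V E" "linkage_free V (- E)" "max_indep V E S" "max_indep V (- E) K"
  shows "card V \<le> card S + card K + 1"
proof -
  have "finite V" using assms(1) by (rule linkage_free.finite_V)
  then show ?thesis using assms
  proof (induction V arbitrary: S K rule: finite_psubset_induct)
    case (psubset V)
    show ?case
    proof (rule ccontr)
      assume "\<not> ?case"
      then have n: "card S + card K + 2 \<le> card V" by simp
      have avoid: "(\<exists>T. max_indep V E T \<and> v \<notin> T) \<and> (\<exists>T. max_indep V (- E) T \<and> v \<notin> T)"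
        if v: "v \<in> V" for v
      proof -
        let ?W = "V - {v}"
        have W: "?W \<subset> V" "finite ?W" "card ?W = card V - 1" using v psubset.hyps by auto
        obtain S' K' where SK: "max_indep ?W E S'" "max_indep ?W (- E) K'"
          using max_indep_exists[OF W(2), of E] max_indep_exists[OF W(2), of "- E"] by auto
        have "card ?W \<le> card S' + card K' + 1"
          using psubset.IH[OF W(1) _ _ SK] linkage_free_mono[OF psubset.prems(1), of ?W]
            linkage_free_mono[OF psubset.prems(2), of ?W] W(1) by blast
        moreover have in_V: "S' \<subseteq> V" "indep S' E" "K' \<subseteq> V" "indep K' (- E)" "v \<notin> S'" "v \<notin> K'"
          using SK by (auto simp: max_indep_def)
        moreover have "card S' \<le> card S" "card K' \<le> card K"
          using max_indepD(3)[OF psubset.prems(3) in_V(1,2)]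
            max_indepD(3)[OF psubset.prems(4) in_V(3,4)] by auto
        ultimately have "card S \<le> card S'" "card K \<le> card K'"
          using n W(3) by linarith+
        then have "max_indep V E S'" "max_indep V (- E) K'"
          using max_indepI_card[OF psubset.prems(3) in_V(1,2)]
            max_indepI_card[OF psubset.prems(4) in_V(3,4)] by auto
        then show ?thesis using in_V by blast
      qed
      show False
      proof (cases "card K \<le> card S")
        case True
        then show False
          using no_critical_graph[of V E S K] psubset.prems n avoid by blast
      next
        case False
        then show False
          using no_critical_graph[of V "- E" K S] psubset.prems n avoid by simp
      qed
    qed
  qed
qed

section \<open>Linked triples in \<open>\<B>\<close>-free graphs\<close>

lemma edge_iff_arc:
  assumes "pair_graph G"
  shows "{u, v} \<in> edges G \<longleftrightarrow> (u, v) \<in> parcs G"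
proof -
  interpret pair_graph G by fact
  show ?thesis
    using arcs_symmetric by (auto simp: edges_def doubleton_eq_iff)
qed

text \<open>
  The induced subgraph on the entries of \<open>p\<close>, carried over to the positions in \<open>p\<close>. This supplies
  the members of \<^const>\<open>class_B\<close>, whose vertices are natural numbers.
\<close>

definition position_graph :: "'a set set \<Rightarrow> 'a list \<Rightarrow> nat pair_pre_digraph" where
  "position_graph E p = \<lparr>pverts = {..<length p},
     parcs = {(i, j). i < length p \<and> j < length p \<and> i \<noteq> j \<and> {p ! i, p ! j} \<in> E}\<rparr>"

lemma pair_graph_position_graph: "pair_graph (position_graph E p)"
proof
  show "finite (parcs (position_graph E p))"
    by (rule finite_subset[of _ "{..<length p} \<times> {..<length p}"]) (auto simp: position_graph_def)
qed (auto simp: position_graph_def symmetric_def sym_def insert_commute)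

lemma complement_position_graph: "complement (position_graph (- E) p) = position_graph E p"
  by (auto simp: complement_def position_graph_def)

lemma position_graph_linked_triples:
  assumes "linked_triples E p"
  shows "position_graph E p \<in> bipartite_six_pm"
proof -
  obtain x y z x' y' z' where p: "p = [x, y, z, x', y', z']" "distinct p"
    and ind: "indep {x, y, z} E" "indep {x', y', z'} E"
    and link: "{x, x'} \<in> E" "{y, y'} \<in> E" "{z, z'} \<in> E"
    using assms by (auto simp: linked_triples_def)
  let ?F = "position_graph E p"
  have len: "length p = 6" using p(1) by simp
  have verts: "pverts ?F = {0, 1, 2, 3, 4, 5}"
    using len by (auto simp: position_graph_def)
  have arc: "(i, j) \<in> parcs ?F \<longleftrightarrow> i < 6 \<and> j < 6 \<and> i \<noteq> j \<and> {p ! i, p ! j} \<in> E" for i j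
    using len by (simp add: position_graph_def)
  have no_arc: "(i, j) \<notin> parcs ?F" if "i < 3 \<and> j < 3 \<or> 3 \<le> i \<and> 3 \<le> j" for i j
  proof
    assume "(i, j) \<in> parcs ?F"
    then have ij: "i < 6" "j < 6" "i \<noteq> j" and e: "{p ! i, p ! j} \<in> E"
      by (auto simp: arc)
    then have ne: "p ! i \<noteq> p ! j"
      using p by (simp add: nth_eq_iff_index_eq)
    have low: "p ! k \<in> {x, y, z}" if "k < 3" for k
      using that p(1) by (auto simp: less_Suc_eq numeral_eq_Suc)
    have high: "p ! k \<in> {x', y', z'}" if "3 \<le> k" "k < 6" for k
    proof -
      have "k = 3 \<or> k = 4 \<or> k = 5" using that by linarith
      then show ?thesis using p(1) by auto
    qed
    show False
      using that ij e ne low high ind unfolding indep_def by blast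
  qed
  have "bipartite ?F"
    unfolding bipartite_def
  proof (intro exI conjI)
    show "pverts ?F = {0, 1, 2} \<union> {3, 4, 5}" using verts by auto
    show "parcs ?F \<subseteq> {0, 1, 2} \<times> {3, 4, 5} \<union> {3, 4, 5} \<times> {0, 1, 2}"
    proof (rule subrelI)
      fix i j assume a: "(i, j) \<in> parcs ?F"
      then have "i < 6" "j < 6" by (auto simp: arc)
      moreover have "i < 3 \<longleftrightarrow> 3 \<le> j" using no_arc[of i j] a by linarith
      moreover have "k \<in> {0, 1, 2}" if "k < 3" for k :: nat using that by auto
      moreover have "k \<in> {3, 4, 5}" if "3 \<le> k" "k < 6" for k :: nat using that by auto
      ultimately show "(i, j) \<in> {0, 1, 2} \<times> {3, 4, 5} \<union> {3, 4, 5} \<times> {0, 1, 2}"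
        by (metis Un_iff mem_Sigma_iff not_le)
    qed
  qed simp
  moreover have "perfect_matching ?F {{0, 3}, {1, 4}, {2, 5}}"
    unfolding perfect_matching_def
  proof
    have "(0, 3) \<in> parcs ?F" "(1, 4) \<in> parcs ?F" "(2, 5) \<in> parcs ?F"
      unfolding arc using link p(1) by simp_all
    then show "{{0, 3}, {1, 4}, {2, 5}} \<subseteq> edges ?F"
      by (auto simp: edges_def)
    have unique: "\<exists>!e. e \<in> {{0, 3}, {1, 4}, {2, 5}} \<and> v \<in> e" if "v \<in> {0, 1, 2, 3, 4, 5}" for v :: nat
      using that by auto
    show "\<forall>v\<in>pverts ?F. \<exists>!e. e \<in> {{0, 3}, {1, 4}, {2, 5}} \<and> v \<in> e"
      by (rule ballI, rule unique, simp only: verts)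
  qed
  ultimately show ?thesis
    using pair_graph_position_graph verts by (auto simp: bipartite_six_pm_def)
qed

lemma position_graph_iso_induced:
  assumes G: "pair_graph G" and p: "set p \<subseteq> pverts G" "distinct p"
  shows "\<exists>H. induced_subgraph (with_proj H) (with_proj G) \<and>
    digraph_iso (with_proj H) (with_proj (position_graph (edges G) p))"
proof (intro exI conjI)
  interpret G: pair_graph G by fact
  let ?H = "\<lparr>pverts = set p, parcs = parcs G \<inter> set p \<times> set p\<rparr>"
  let ?F = "position_graph (edges G) p"
  interpret F: pair_graph ?F by (rule pair_graph_position_graph)
  interpret H: pair_wf_digraph ?H by unfold_locales auto
  show "induced_subgraph (with_proj ?H) (with_proj G)"
    using p(1) G.wf_digraph_axioms H.wf_digraph_axioms
    by (auto simp: induced_subgraph_def subgraph_def compatible_def)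
  let ?h = "\<lparr>iso_verts = (!) p, iso_arcs = (\<lambda>(i, j). (p ! i, p ! j)), iso_head = snd, iso_tail = fst\<rparr>"
  have nth_inj: "i = j" if "i < length p" "j < length p" "p ! i = p ! j" for i j
    using that p(2) by (simp add: nth_eq_iff_index_eq)
  have "F.digraph_isomorphism ?h"
    using F.wf_digraph_axioms nth_inj
    by (auto simp: pre_digraph.digraph_isomorphism_def inj_on_def position_graph_def)
  moreover have "with_proj ?H = app_iso ?h (with_proj ?F)"
  proof (rule pre_digraph.equality)
    have "set p = (!) p ` {..<length p}"
      by (auto simp: in_set_conv_nth)
    then show "verts (with_proj ?H) = verts (app_iso ?h (with_proj ?F))"
      by (simp add: position_graph_def)
    have "(u, v) \<in> (\<lambda>(i, j). (p ! i, p ! j)) ` parcs ?F"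
      if a: "(u, v) \<in> parcs G" "u \<in> set p" "v \<in> set p" for u v
    proof -
      obtain i j where ij: "i < length p" "p ! i = u" "j < length p" "p ! j = v"
        using a by (auto simp: in_set_conv_nth)
      then have "(i, j) \<in> parcs ?F"
        using a G.pair_no_loops[OF a(1)] by (auto simp: position_graph_def edge_iff_arc[OF G])
      then show ?thesis using ij by force
    qed
    then show "arcs (with_proj ?H) = arcs (app_iso ?h (with_proj ?F))"
      by (auto simp: position_graph_def edge_iff_arc[OF G])
  qed auto
  ultimately have "digraph_iso (with_proj ?F) (with_proj ?H)"
    by (auto simp: digraph_iso_def)
  then show "digraph_iso (with_proj ?H) (with_proj ?F)"
    by (rule digraph_iso_swap[OF F.wf_digraph_axioms])
qed

lemma linkage_free_if_B_free:
  assumes G: "pair_graph G" and B: "B_free G"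
  shows "linkage_free (pverts G) (edges G)" "linkage_free (pverts G) (- edges G)"
proof -
  interpret pair_graph G by fact
  have no: "position_graph (edges G) p \<notin> class_B" if "set p \<subseteq> pverts G" "distinct p" for p
    using position_graph_iso_induced[OF G that] B by (auto simp: B_free_def)
  have dist: "distinct p" if "linked_triples E p" for E and p :: "'a list"
    using that by (auto simp: linked_triples_def)
  show "linkage_free (pverts G) (edges G)"
  proof
    fix p assume "set p \<subseteq> pverts G"
    then show "\<not> linked_triples (edges G) p"
      using no[of p] dist[of _ p] position_graph_linked_triples[of _ p] by (auto simp: class_B_def)
  qed (rule pair_finite_verts)
  show "linkage_free (pverts G) (- edges G)"
  proof
    fix p assume "set p \<subseteq> pverts G"
    then show "\<not> linked_triples (- edges G) p"
      using no[of p] dist[of _ p] position_graph_linked_triples[of _ p]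
        complement_position_graph[of "edges G" p]
      by (metis UnCI class_B_def imageI)
  qed (rule pair_finite_verts)
qed

section \<open>The bound on stability and clique number\<close>

lemma Max_card_indep_eq:
  assumes "finite V" "max_indep V E S"
  shows "Max {card T | T. T \<subseteq> V \<and> indep T E} = card S"
proof (rule Max_eqI)
  show "finite {card T | T. T \<subseteq> V \<and> indep T E}"
    using assms(1) by simp
  show "card S \<in> {card T | T. T \<subseteq> V \<and> indep T E}"
    using max_indepD(1,2)[OF assms(2)] by blast
qed (use max_indepD(3)[OF assms(2)] in blast)

theorem theorem1p1:
  fixes G :: "'a pair_pre_digraph"
  assumes "pair_graph G"
    and "B_free G"
  shows "int (stability_number G) + int (clique_number G) \<ge> int (card (pverts G)) - 1"
proof -
  note free = linkage_free_if_B_free[OF assms]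
  have fin: "finite (pverts G)"
    using free(1) by (rule linkage_free.finite_V)
  obtain S where S: "max_indep (pverts G) (edges G) S"
    using max_indep_exists[OF fin] by blast
  obtain K where K: "max_indep (pverts G) (- edges G) K"
    using max_indep_exists[OF fin] by blast
  have "stability_number G = card S"
    unfolding stability_number_def by (rule Max_card_indep_eq[OF fin S])
  moreover have "clique_number G = card K"
    unfolding clique_number_def using Max_card_indep_eq[OF fin K] by simp
  ultimately show ?thesis
    using card_le_of_linkage_free[OF free S K] by linarith
qed

end
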